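(* Let $G=([n],E)$ be a connected undirected graph whose Laplacian has exactly $k+1$ distinct eigenvalues, and let $1\le t\le k-1$. Then there exists a proper subset $W\subsetneq[n]$ that is a uniformly weighted design of $G$ of strength $t$ if and only if the $t$-th eigenconfiguration $\mathcal{B}_t$ of $G$ is $2$-valued.
   Context: $[n]=\{1,\dots,n\}$. The Laplacian $L$ of $G$ is the $n\times n$ matrix with $L_{ii}=\deg(i)$, $L_{ij}=-1$ if $\{i,j\}\in E$, and $L_{ij}=0$ otherwise. Let $0=\lambda_0<\lambda_1<\cdots<\lambda_k$ be its distinct eigenvalues, with eigenspaces $\Lambda_0,\dots,\Lambda_k\subset\mathbb{R}^n$ (vectors are viewed as functions $[n]\to\mathbb{R}$) of dimensions $d_0,\dots,d_k$; $\Lambda_0$ is spanned by the all-ones vector. A subset $W\subset[n]$ with weights $a_w\in\mathbb{R}$ ($w\in W$) averages $f:[n]\to\mathbb{R}$ if $\frac1n\sum_{v\in[n]}f(v)=\sum_{w\in W}a_wf(w)$. It is a graphical design of strength $t$ if it averages every $f\in\Lambda_0\oplus\Lambda_1\oplus\cdots\oplus\Lambda_t$. The design is uniformly weighted if there is $a>0$ with $a_w=a$ for all $w\in W$; a set $W$ is called a uniformly weighted design of strength $t$ if it is one for some such $a$. Let $\beta=\sum_{i=t+1}^k d_i$ and let $B\in\mathbb{R}^{\beta\times n}$ be a matrix whose rows are the union of chosen bases of $\Lambda_{t+1},\dots,\Lambda_k$. The $t$-th eigenconfiguration $\mathcal{B}_t=\{b_1,\dots,b_n\}\subset\mathbb{R}^\beta$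 is the multiset of columns of $B$. (The choice of bases is arbitrary; different choices differ by an invertible linear transformation.) A point configuration $\mathcal{P}=\{p_1,\dots,p_r\}\subset\mathbb{R}^d$ that is not contained in an affine hyperplane is $2$-valued if there is a linear functional $a^\top x$ that takes exactly two values on the points of $\mathcal{P}$. *)

theory Defs
  imports "HOL-Analysis.Analysis" "HOL-Library.Multiset"
begin

text \<open>
  The vertex set \<open>[n]\<close> is a finite type \<open>'n\<close> with \<open>n = CARD('n)\<close>, and a function
  \<open>[n] \<rightarrow> \<real>\<close> is a vector of type \<open>real ^ 'n\<close>. A graph is given by its set of edges,
  which are two-element sets of vertices.
\<close>

definition simple_graph :: "'n::finite set set \<Rightarrow> bool" where
  "simple_graph E \<longleftrightarrow> (\<forall>e\<in>E. card e = 2)"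

definition connected_graph :: "'n::finite set set \<Rightarrow> bool" where
  "connected_graph E \<longleftrightarrow> (\<forall>u v. (u, v) \<in> {(x, y). {x, y} \<in> E}\<^sup>*)"

definition degree :: "'n::finite set set \<Rightarrow> 'n \<Rightarrow> nat" where
  "degree E v = card {e \<in> E. v \<in> e}"

definition laplacian :: "'n::finite set set \<Rightarrow> real ^ 'n ^ 'n" where
  "laplacian E =
    (\<chi> i j. if i = j then real (degree E i) else if {i, j} \<in> E then - 1 else 0)"

definition eigenvalues :: "real ^ 'n ^ 'n::finite \<Rightarrow> real set" where
  "eigenvalues A = {l. \<exists>f. f \<noteq> 0 \<and> A *v f = l *\<^sub>R f}"

definition eigenspace :: "real ^ 'n ^ 'n::finite \<Rightarrow> real \<Rightarrow> (real ^ 'n) set" where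
  "eigenspace A l = {f. A *v f = l *\<^sub>R f}"

text \<open>
  \<open>lap_eigenvalue E i\<close> is \<open>\<lambda>\<^sub>i\<close>, the distinct eigenvalues being listed in increasing order
  starting from index \<open>0\<close>; it is meaningful for \<open>i < card (eigenvalues (laplacian E))\<close> only.
\<close>

definition lap_eigenvalue :: "'n::finite set set \<Rightarrow> nat \<Rightarrow> real" where
  "lap_eigenvalue E i = sorted_list_of_set (eigenvalues (laplacian E)) ! i"

definition lap_eigenspace :: "'n::finite set set \<Rightarrow> nat \<Rightarrow> (real ^ 'n) set" where
  "lap_eigenspace E i = eigenspace (laplacian E) (lap_eigenvalue E i)"

definition averages :: "'n::finite set \<Rightarrow> ('n \<Rightarrow> real) \<Rightarrow> real ^ 'n \<Rightarrow> bool" where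
  "averages W a f \<longleftrightarrow>
    (1 / real CARD('n)) * (\<Sum>v\<in>UNIV. f $ v) = (\<Sum>w\<in>W. a w * f $ w)"

text \<open>
  The internal direct sum \<open>\<Lambda>\<^sub>0 \<oplus> \<dots> \<oplus> \<Lambda>\<^sub>t\<close> is the span of the union of its summands.
\<close>

definition graphical_design ::
    "'n::finite set set \<Rightarrow> nat \<Rightarrow> 'n set \<Rightarrow> ('n \<Rightarrow> real) \<Rightarrow> bool" where
  "graphical_design E t W a \<longleftrightarrow>
    (\<forall>f \<in> span (\<Union>i\<in>{0..t}. lap_eigenspace E i). averages W a f)"

definition uniformly_weighted_design :: "'n::finite set set \<Rightarrow> nat \<Rightarrow> 'n set \<Rightarrow> bool" where
  "uniformly_weighted_design E t W \<longleftrightarrow>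
    (\<exists>a. graphical_design E t W a \<and> (\<exists>c>0. \<forall>w\<in>W. a w = c))"

definition is_basis :: "'v::real_vector set \<Rightarrow> 'v set \<Rightarrow> bool" where
  "is_basis S V \<longleftrightarrow> independent S \<and> span S = V"

text \<open>
  \<open>eigenbasis_matrix E k t B\<close>: the rows of the \<open>\<beta> \<times> n\<close> matrix \<open>B\<close> are the union of bases of
  \<open>\<Lambda>\<^sub>t\<^sub>+\<^sub>1, \<dots>, \<Lambda>\<^sub>k\<close>. The number \<open>\<beta>\<close> of rows is the cardinality of the index type \<open>'b\<close>;
  since it equals the sum of the dimensions, no row can be repeated.
\<close>

definition eigenbasis_matrix ::
    "'n::finite set set \<Rightarrow> nat \<Rightarrow> nat \<Rightarrow> real ^ 'n ^ 'b::finite \<Rightarrow> bool" where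
  "eigenbasis_matrix E k t B \<longleftrightarrow>
    CARD('b) = (\<Sum>i\<in>{t+1..k}. dim (lap_eigenspace E i)) \<and>
    (\<exists>S. (\<forall>i\<in>{t+1..k}. is_basis (S i) (lap_eigenspace E i)) \<and>
         rows B = (\<Union>i\<in>{t+1..k}. S i))"

definition eigenconfiguration :: "real ^ 'n::finite ^ 'b::finite \<Rightarrow> (real ^ 'b) multiset" where
  "eigenconfiguration B = image_mset (\<lambda>j. column j B) (mset_set UNIV)"

definition in_affine_hyperplane :: "'v::euclidean_space set \<Rightarrow> bool" where
  "in_affine_hyperplane P \<longleftrightarrow> (\<exists>a c. a \<noteq> 0 \<and> P \<subseteq> {x. a \<bullet> x = c})"

definition two_valued :: "'v::euclidean_space multiset \<Rightarrow> bool" where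
  "two_valued P \<longleftrightarrow> \<not> in_affine_hyperplane (set_mset P) \<and>
    (\<exists>a. card ((\<lambda>x. a \<bullet> x) ` set_mset P) = 2)"

end

theory Submission
  imports Defs
begin

text \<open>
  Put \<open>L = \<Lambda>\<^sub>0 \<oplus> \<dots> \<oplus> \<Lambda>\<^sub>t\<close> and \<open>H = \<Lambda>\<^sub>t\<^sub>+\<^sub>1 \<oplus> \<dots> \<oplus> \<Lambda>\<^sub>k\<close>. A set \<open>W\<close> with constant weight \<open>c\<close>
  is a design of strength \<open>t\<close> iff \<open>c 1\<^sub>W - 1/n\<close> is orthogonal to \<open>L\<close>, which by the spectral
  theorem means that it lies in \<open>H\<close>, the row space of \<open>B\<close>. The elements of \<open>H\<close> are exactly the
  value vectors of linear functionals on the eigenconfiguration, so a design gives a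
  functional with the two values \<open>c - 1/n\<close> and \<open>-1/n\<close>. Conversely, two values \<open>p < q\<close> taken by
  an element of \<open>H\<close> satisfy \<open>p < 0\<close> because \<open>H\<close> is orthogonal to the all-ones vector, and
  scaling by \<open>-1/(n p)\<close> turns that element into \<open>c 1\<^sub>W - 1/n\<close> with \<open>c > 0\<close>.
\<close>

section \<open>Symmetric matrices\<close>

lemma symmetric_dot:
  fixes A :: "real ^ 'n ^ 'n::finite"
  assumes "transpose A = A"
  shows "(A *v x) \<bullet> y = x \<bullet> (A *v y)"
  by (metis assms dot_lmul_matrix inner_commute transpose_matrix_vector)

lemma eigenspace_orthogonal:
  assumes "transpose A = A" "x \<in> eigenspace A l" "y \<in> eigenspace A m" "l \<noteq> m"
  shows "x \<bullet> y = 0"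
  using symmetric_dot[OF assms(1), of x y] assms(2-4) by (simp add: eigenspace_def)

lemma eigenspace_trivial: "l \<notin> eigenvalues A \<Longrightarrow> eigenspace A l \<subseteq> {0}"
  by (auto simp: eigenvalues_def eigenspace_def)

text \<open>First-order condition at a maximum: for small \<open>s\<close> the linear term dominates
  the quadratic one and has either sign.\<close>

lemma linear_coeff_zero_if_quadratic_nonpos:
  fixes b c :: real
  assumes "\<And>s. 2 * s * b + s\<^sup>2 * c \<le> 0"
  shows "b = 0"
proof (rule ccontr)
  assume "b \<noteq> 0"
  \<comment> \<open>This \<open>s\<close> has the sign of \<open>b\<close> and satisfies
    \<open>\<bar>s * c\<bar> < \<bar>b\<bar>\<close>, so the quadratic term cannot cancel
    \<open>2 * s * b\<close>.\<close>
  define s where "s = b / (\<bar>c\<bar> + 1)"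
  have s: "s * (\<bar>c\<bar> + 1) = b" by (simp add: s_def)
  have "s \<noteq> 0" using \<open>b \<noteq> 0\<close> s by auto
  have "2 * s * b + s\<^sup>2 * c = s\<^sup>2 * (2 * \<bar>c\<bar> + 2 + c)"
    by (simp add: s[symmetric] power2_eq_square algebra_simps)
  moreover have "\<dots> > 0" using \<open>s \<noteq> 0\<close> by (intro mult_pos_pos) auto
  ultimately show False using assms[of s] by simp
qed

text \<open>The eigenvector is a maximiser of the quadratic form on the unit sphere of the subspace.\<close>

lemma symmetric_invariant_subspace_eigenvector:
  fixes A :: "real ^ 'n ^ 'n::finite"
  assumes sym: "transpose A = A" and V: "subspace V" "V \<noteq> {0}"
    and inv: "\<And>x. x \<in> V \<Longrightarrow> A *v x \<in> V"
  obtains x l where "x \<in> V" "x \<noteq> 0" "A *v x = l *\<^sub>R x"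
proof -
  let ?S = "V \<inter> sphere 0 1"
  obtain v where v: "v \<in> V" "v \<noteq> 0" using V subspace_0 by blast
  have "compact ?S" by (simp add: V(1) closed_Int_compact closed_subspace)
  moreover have "v /\<^sub>R norm v \<in> ?S" using v V(1) by (simp add: subspace_scale)
  then have "?S \<noteq> {}" by blast
  moreover have "continuous_on ?S (\<lambda>x. (A *v x) \<bullet> x)"
    by (intro continuous_intros)
  ultimately obtain x where x: "x \<in> ?S" and
    max: "\<And>y. y \<in> ?S \<Longrightarrow> (A *v y) \<bullet> y \<le> (A *v x) \<bullet> x"
    using continuous_attains_sup by meson
  define m where "m = (A *v x) \<bullet> x"
  \<comment> \<open>Both sides scale by the square of the norm, so the maximum on the sphere bounds
    the form on all of \<open>V\<close>.\<close>
  have bound: "(A *v y) \<bullet> y \<le> m * (y \<bullet> y)" if "y \<in> V" for y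
  proof (cases "y = 0")
    case False
    let ?y = "y /\<^sub>R norm y"
    have "?y \<in> ?S" using that False V(1) by (simp add: subspace_scale)
    then have "(A *v ?y) \<bullet> ?y \<le> m" using max m_def by blast
    then have "(A *v y) \<bullet> y / (norm y)\<^sup>2 \<le> m"
      by (simp add: matrix_vector_mult_scaleR power2_eq_square divide_simps)
    then show ?thesis using False by (simp add: dot_square_norm divide_simps)
  qed simp
  \<comment> \<open>By \<open>bound\<close>,
    \<open>(A *v y) \<bullet> y - m * (y \<bullet> y)\<close> is nonpositive on \<open>V\<close> and
    vanishes at \<open>x\<close>; on the line \<open>x + s *\<^sub>R v\<close> its linear
    coefficient is therefore zero.\<close>
  have ortho: "(A *v x - m *\<^sub>R x) \<bullet> v = 0" if "v \<in> V" for v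
  proof (rule linear_coeff_zero_if_quadratic_nonpos)
    fix s :: real
    have "x + s *\<^sub>R v \<in> V" using x that V(1) by (simp add: subspace_add subspace_scale)
    from bound[OF this]
    have "(A *v x) \<bullet> x + s * ((A *v x) \<bullet> v) + s * ((A *v v) \<bullet> x) + s * s * ((A *v v) \<bullet> v)
        \<le> m * (x \<bullet> x + 2 * s * (x \<bullet> v) + s * s * (v \<bullet> v))"
      by (simp add: matrix_vector_right_distrib matrix_vector_mult_scaleR inner_add_left
          inner_add_right inner_commute algebra_simps)
    moreover have "x \<bullet> x = 1" using x by (simp add: dot_square_norm)
    moreover have "(A *v v) \<bullet> x = (A *v x) \<bullet> v"
      using symmetric_dot[OF sym, of v x] by (simp add: inner_commute)
    ultimately show "2 * s * ((A *v x - m *\<^sub>R x) \<bullet> v) + s\<^sup>2 * ((A *v v) \<bullet> v - m * (v \<bullet> v)) \<le> 0"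
      by (simp add: m_def inner_diff_left power2_eq_square algebra_simps)
  qed
  \<comment> \<open>The residual lies in \<open>V\<close> and is orthogonal to \<open>V\<close>,
    hence to itself.\<close>
  have "A *v x - m *\<^sub>R x \<in> V" using x inv V(1) by (simp add: subspace_diff subspace_scale)
  then have "A *v x = m *\<^sub>R x" using ortho by fastforce
  moreover have "x \<noteq> 0" using x by auto
  ultimately show thesis using that x by blast
qed

text \<open>The orthogonal complement \<open>V\<close> of all eigenvectors is invariant under
  \<open>A\<close>. If it were nonzero it would contain an eigenvector, which would be orthogonal to
  itself.\<close>

theorem symmetric_eigenspaces_span:
  fixes A :: "real ^ 'n ^ 'n::finite"
  assumes sym: "transpose A = A"
  shows "span (\<Union>l. eigenspace A l) = UNIV"
proof (rule ccontr)
  let ?U = "\<Union>l. eigenspace A l"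
  define V where "V = {x. \<forall>y\<in>?U. x \<bullet> y = 0}"
  assume "span ?U \<noteq> UNIV"
  then have "span ?U \<subset> span UNIV" by auto
  then obtain z where "z \<noteq> 0" and z: "\<And>y. y \<in> span ?U \<Longrightarrow> orthogonal z y"
    using orthogonal_to_subspace_exists_gen by metis
  have "z \<bullet> y = 0" if "y \<in> ?U" for y
    using z[OF span_base[OF that]] by (simp only: orthogonal_def)
  then have "z \<in> V" unfolding V_def by blast
  with \<open>z \<noteq> 0\<close> have "V \<noteq> {0}" by blast
  have "subspace V" by (auto simp: V_def subspace_def inner_add_left)
  have "A *v x \<in> V" if "x \<in> V" for x
    using that by (auto simp: V_def symmetric_dot[OF sym] eigenspace_def)
  then obtain x l where "x \<in> V" "x \<noteq> 0" "A *v x = l *\<^sub>R x"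
    using symmetric_invariant_subspace_eigenvector[OF sym \<open>subspace V\<close> \<open>V \<noteq> {0}\<close>] by blast
  then have "x \<bullet> x = 0" by (auto simp: V_def eigenspace_def)
  with \<open>x \<noteq> 0\<close> show False by simp
qed

section \<open>Orthogonal sums of eigenspaces\<close>

lemma span_orthogonal:
  fixes S T :: "'a::euclidean_space set"
  assumes "\<And>x y. x \<in> S \<Longrightarrow> y \<in> T \<Longrightarrow> x \<bullet> y = 0" "x \<in> span S" "y \<in> span T"
  shows "x \<bullet> y = 0"
proof -
  have "orthogonal x b" if "b \<in> T" for b
    using orthogonal_to_span[of x S b] assms(1,2) that
    by (metis orthogonal_commute orthogonal_def)
  then show ?thesis
    using orthogonal_to_span[OF assms(3)] by (auto simp: orthogonal_def)
qed

text \<open>Split \<open>z = u + v\<close> along \<open>I\<close> and \<open>J\<close>. Then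
  \<open>u\<close> is orthogonal to \<open>v\<close> (distinct eigenvalues) and to \<open>z\<close>
  (hypothesis), so \<open>u \<bullet> u = 0\<close>.\<close>

lemma orthogonal_eigenspaces_in_span:
  fixes A :: "real ^ 'n ^ 'n::finite"
  assumes sym: "transpose A = A" and sub: "eigenvalues A \<subseteq> I \<union> J" and "I \<inter> J = {}"
    and z: "\<And>l x. l \<in> I \<Longrightarrow> x \<in> eigenspace A l \<Longrightarrow> z \<bullet> x = 0"
  shows "z \<in> span (\<Union>l\<in>J. eigenspace A l)"
proof -
  let ?I = "\<Union>l\<in>I. eigenspace A l" and ?J = "\<Union>l\<in>J. eigenspace A l"
  \<comment> \<open>The union runs over all reals; those that are not eigenvalues contribute only
    \<open>0\<close>.\<close>
  have "(\<Union>l. eigenspace A l) \<subseteq> insert 0 (?I \<union> ?J)"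
    using eigenspace_trivial[of _ A] sub by blast
  from span_mono[OF this] have "z \<in> span (?I \<union> ?J)"
    by (simp only: symmetric_eigenspaces_span[OF sym] span_insert_0 top.extremum_unique UNIV_I)
  then obtain u v where uv: "u \<in> span ?I" "v \<in> span ?J" "z = u + v"
    by (auto simp: span_Un)
  have "u \<bullet> v = 0"
  proof (rule span_orthogonal[OF _ uv(1,2)])
    fix x y
    assume "x \<in> ?I" "y \<in> ?J"
    then obtain l m where "l \<in> I" "m \<in> J" "x \<in> eigenspace A l" "y \<in> eigenspace A m"
      by blast
    then show "x \<bullet> y = 0"
      using \<open>I \<inter> J = {}\<close> by (intro eigenspace_orthogonal[OF sym, of x l y m]) auto
  qed
  moreover have "z \<bullet> u = 0"
    by (rule span_orthogonal[OF _ span_base[of z "{z}"] uv(1)]) (use z in auto)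
  ultimately have "u \<bullet> u = 0" by (simp only: uv(3) inner_add_left inner_commute[of v u] add_0_right)
  then show ?thesis using uv by simp
qed

lemma dim_Union_orthogonal:
  fixes V :: "'i \<Rightarrow> 'a::euclidean_space set"
  assumes "finite I"
    and "\<And>i j x y. i \<in> I \<Longrightarrow> j \<in> I \<Longrightarrow> i \<noteq> j \<Longrightarrow> x \<in> V i \<Longrightarrow> y \<in> V j \<Longrightarrow> x \<bullet> y = 0"
  shows "dim (\<Union>i\<in>I. V i) = (\<Sum>i\<in>I. dim (V i))"
  using assms
proof (induction I)
  case (insert a I)
  have "dim (V a \<union> (\<Union>i\<in>I. V i)) = dim (V a) + dim (\<Union>i\<in>I. V i)"
    by (rule dim_orthogonal_sum) (use insert.hyps insert.prems in blast)
  moreover have "dim (\<Union>i\<in>I. V i) = (\<Sum>i\<in>I. dim (V i))"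
    by (rule insert.IH) (use insert.prems in blast)
  ultimately show ?case using insert.hyps by simp
qed simp

section \<open>The Laplacian\<close>

lemma transpose_laplacian: "transpose (laplacian E) = laplacian E"
proof -
  have "{i, j} = {j, i}" for i j :: 'a by blast
  then show ?thesis unfolding transpose_def laplacian_def by (simp add: vec_eq_iff)
qed

lemma degree_eq_card_neighbours:
  assumes "simple_graph E"
  shows "degree E v = card {w. {v, w} \<in> E}"
proof -
  have "\<exists>w. e = {v, w}" if "e \<in> E" "v \<in> e" for e
  proof -
    have "card e = 2" using assms that(1) by (simp add: simple_graph_def)
    then obtain x y where "e = {x, y}" by (auto simp: card_2_iff)
    then show ?thesis using that(2) by blast
  qed
  then have "{e \<in> E. v \<in> e} = (\<lambda>w. {v, w}) ` {w. {v, w} \<in> E}" by blast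
  moreover have "inj_on (\<lambda>w. {v, w}) {w. {v, w} \<in> E}"
    by (auto simp: inj_on_def doubleton_eq_iff)
  ultimately show ?thesis by (simp add: degree_def card_image)
qed

text \<open>The Laplacian as a difference operator: in this form constants are visibly in its kernel
  and its quadratic form can be symmetrised.\<close>

lemma laplacian_mult_nth:
  assumes "simple_graph E"
  shows "(laplacian E *v f) $ i = (\<Sum>j\<in>UNIV. if {i, j} \<in> E then f $ i - f $ j else 0)"
proof -
  \<comment> \<open>Without loops, the diagonal and the edge entries never compete for the same
    position.\<close>
  have loop: "{i} \<notin> E" using assms by (auto simp: simple_graph_def)
  have "(laplacian E *v f) $ i = (\<Sum>j\<in>UNIV. (if j = i then real (degree E i) * f $ i else 0)
      - (if {i, j} \<in> E then f $ j else 0))"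
    using loop by (auto simp: laplacian_def matrix_vector_mult_def intro!: sum.cong)
  also have "\<dots> = (\<Sum>j\<in>UNIV. if {i, j} \<in> E then f $ i else 0)
      - (\<Sum>j\<in>UNIV. if {i, j} \<in> E then f $ j else 0)"
    by (simp add: sum_subtractf degree_eq_card_neighbours[OF assms] sum.If_cases)
  also have "\<dots> = (\<Sum>j\<in>UNIV. if {i, j} \<in> E then f $ i - f $ j else 0)"
    by (auto simp: sum_subtractf[symmetric] intro!: sum.cong)
  finally show ?thesis .
qed

text \<open>Adding the double sum to its copy with \<open>i\<close> and \<open>j\<close> swapped
  turns twice the form into a sum of squares \<open>(f $ i - f $ j)\<^sup>2\<close> over adjacent
  pairs.\<close>

lemma laplacian_psd:
  assumes "simple_graph E"
  shows "f \<bullet> (laplacian E *v f) \<ge> 0"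
proof -
  let ?g = "\<lambda>i j. if {i, j} \<in> E then f $ i * (f $ i - f $ j) else 0"
  have eq: "f \<bullet> (laplacian E *v f) = (\<Sum>i\<in>UNIV. \<Sum>j\<in>UNIV. ?g i j)"
    by (auto simp: inner_vec_def laplacian_mult_nth[OF assms] sum_distrib_left
        intro!: sum.cong)
  have "2 * (f \<bullet> (laplacian E *v f)) = (\<Sum>i\<in>UNIV. \<Sum>j\<in>UNIV. ?g i j + ?g j i)"
    using sum.swap[of ?g UNIV UNIV] by (simp add: eq sum.distrib)
  also have "\<dots> = (\<Sum>i\<in>UNIV. \<Sum>j\<in>UNIV. if {i, j} \<in> E then (f $ i - f $ j)\<^sup>2 else 0)"
    by (intro sum.cong refl) (simp add: insert_commute power2_eq_square algebra_simps)
  also have "\<dots> \<ge> 0" by (intro sum_nonneg) auto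
  finally show ?thesis by simp
qed

lemma eigenvalues_laplacian_nonneg:
  assumes "simple_graph E" "l \<in> eigenvalues (laplacian E)"
  shows "l \<ge> 0"
proof -
  obtain f where "f \<noteq> 0" "laplacian E *v f = l *\<^sub>R f"
    using assms(2) by (auto simp: eigenvalues_def)
  moreover have "f \<bullet> f > 0" using \<open>f \<noteq> 0\<close> by simp
  moreover have "f \<bullet> (laplacian E *v f) \<ge> 0" by (rule laplacian_psd[OF assms(1)])
  ultimately show ?thesis by (metis inner_scaleR_right not_less zero_le_mult_iff)
qed

lemma ones_in_eigenspace_laplacian:
  assumes "simple_graph E"
  shows "1 \<in> eigenspace (laplacian E) 0"
  by (auto simp: eigenspace_def vec_eq_iff laplacian_mult_nth[OF assms] intro!: sum.neutral)

text \<open>Zero is an eigenvalue and none is negative, so it heads the sorted list and has index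
  0.\<close>

lemma ones_in_lap_eigenspace_0:
  fixes E :: "'n::finite set set"
  assumes "simple_graph E" "finite (eigenvalues (laplacian E))"
  shows "1 \<in> lap_eigenspace E 0"
proof -
  let ?X = "eigenvalues (laplacian E)"
  have "(1 :: real ^ 'n) \<noteq> 0" by (simp add: vec_eq_iff)
  then have 0: "0 \<in> ?X"
    using ones_in_eigenspace_laplacian[OF assms(1)]
    unfolding eigenvalues_def eigenspace_def by blast
  then have "Min ?X = 0"
    using assms by (intro Min_eqI) (auto intro: eigenvalues_laplacian_nonneg)
  moreover have "sorted_list_of_set ?X = Min ?X # sorted_list_of_set (?X - {Min ?X})"
    using 0 assms(2) by (intro sorted_list_of_set_nonempty) auto
  ultimately have "lap_eigenvalue E 0 = 0" by (simp add: lap_eigenvalue_def)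
  then show ?thesis
    using ones_in_eigenspace_laplacian[OF assms(1)] by (simp add: lap_eigenspace_def)
qed

section \<open>Designs and the eigenconfiguration\<close>

lemma eigenvalues_laplacian_conv_image:
  assumes "card (eigenvalues (laplacian E)) = k + 1"
  shows "eigenvalues (laplacian E) = lap_eigenvalue E ` {0..k}"
proof -
  let ?xs = "sorted_list_of_set (eigenvalues (laplacian E))"
  \<comment> \<open>An infinite set has \<open>card\<close> 0, so a positive \<open>card\<close>
    gives finiteness.\<close>
  have fin: "finite (eigenvalues (laplacian E))" using assms by (intro card_ge_0_finite) simp
  have "length ?xs = k + 1" using assms by simp
  moreover have "set ?xs = (!) ?xs ` {0..<length ?xs}"
    by (metis list.set_map map_nth set_upt)
  ultimately show ?thesis
    using fin by (simp add: lap_eigenvalue_def atLeastLessThanSuc_atLeastAtMost)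
qed

lemma inj_on_lap_eigenvalue:
  assumes "card (eigenvalues (laplacian E)) = k + 1"
  shows "inj_on (lap_eigenvalue E) {0..k}"
proof (rule eq_card_imp_inj_on)
  show "card (lap_eigenvalue E ` {0..k}) = card {0..k}"
    unfolding eigenvalues_laplacian_conv_image[OF assms, symmetric] using assms by simp
qed simp

lemma lap_eigenspace_orthogonal:
  assumes "card (eigenvalues (laplacian E)) = k + 1"
    and "i \<le> k" "j \<le> k" "i \<noteq> j" "x \<in> lap_eigenspace E i" "y \<in> lap_eigenspace E j"
  shows "x \<bullet> y = 0"
proof -
  have "lap_eigenvalue E i \<noteq> lap_eigenvalue E j"
    using inj_on_lap_eigenvalue[OF assms(1)] assms(2-4) by (auto simp: inj_on_def)
  then show ?thesis
    using eigenspace_orthogonal[OF transpose_laplacian] assms(5,6)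
    by (auto simp: lap_eigenspace_def)
qed

text \<open>The indices up to \<open>t\<close> and those above it split the spectrum, so the two
  spans are orthogonal complements of each other.\<close>

lemma orthogonal_low_iff_in_high:
  assumes card: "card (eigenvalues (laplacian E)) = k + 1" and "t \<le> k"
  shows "(\<forall>f \<in> span (\<Union>i\<in>{0..t}. lap_eigenspace E i). z \<bullet> f = 0) \<longleftrightarrow>
    z \<in> span (\<Union>i\<in>{t+1..k}. lap_eigenspace E i)" (is "?L \<longleftrightarrow> ?R")
proof
  assume ?L
  let ?I = "lap_eigenvalue E ` {0..t}" and ?J = "lap_eigenvalue E ` {t+1..k}"
  have split: "{0..k} = {0..t} \<union> {t+1..k}" using \<open>t \<le> k\<close> by auto
  have "?I \<inter> ?J = lap_eigenvalue E ` ({0..t} \<inter> {t+1..k})"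
    using \<open>t \<le> k\<close> by (intro inj_on_image_Int[OF inj_on_lap_eigenvalue[OF card], symmetric]) auto
  then have disj: "?I \<inter> ?J = {}" by simp
  have cover: "eigenvalues (laplacian E) \<subseteq> ?I \<union> ?J"
    unfolding eigenvalues_laplacian_conv_image[OF card] split by blast
  have "z \<bullet> x = 0" if "l \<in> ?I" "x \<in> eigenspace (laplacian E) l" for l x
  proof -
    have "x \<in> (\<Union>i\<in>{0..t}. lap_eigenspace E i)"
      using that by (auto simp: lap_eigenspace_def)
    then show ?thesis using \<open>?L\<close> span_base by blast
  qed
  from orthogonal_eigenspaces_in_span[OF transpose_laplacian cover disj this]
  have "z \<in> span (\<Union>l\<in>?J. eigenspace (laplacian E) l)" .
  then show ?R by (simp add: lap_eigenspace_def)
next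
  assume ?R
  have ortho: "x \<bullet> y = 0"
    if xy: "x \<in> (\<Union>i\<in>{t+1..k}. lap_eigenspace E i)" "y \<in> (\<Union>i\<in>{0..t}. lap_eigenspace E i)" for x y
  proof -
    obtain i j where "i \<in> {t+1..k}" "j \<in> {0..t}" "x \<in> lap_eigenspace E i" "y \<in> lap_eigenspace E j"
      using xy by blast
    then show ?thesis using \<open>t \<le> k\<close> by (intro lap_eigenspace_orthogonal[OF card, of i j]) auto
  qed
  show ?L by (rule ballI, rule span_orthogonal[OF ortho \<open>?R\<close>])
qed

lemma averages_const_iff_orthogonal:
  fixes W :: "'n::finite set"
  shows "averages W (\<lambda>_. c) f \<longleftrightarrow>
    (\<chi> v. (if v \<in> W then c else 0) - 1 / real CARD('n)) \<bullet> f = 0"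
proof -
  have "(\<chi> v. (if v \<in> W then c else 0) - 1 / real CARD('n)) \<bullet> f =
      (\<Sum>v\<in>UNIV. if v \<in> W then c * f $ v else 0) - (\<Sum>v\<in>UNIV. 1 / real CARD('n) * f $ v)"
    unfolding inner_vec_def sum_subtractf[symmetric]
    by (intro sum.cong refl) (simp add: left_diff_distrib)
  also have "\<dots> = (\<Sum>w\<in>W. c * f $ w) - 1 / real CARD('n) * (\<Sum>v\<in>UNIV. f $ v)"
    by (simp add: sum.If_cases sum_distrib_left)
  finally show ?thesis by (auto simp: averages_def)
qed

lemma uniformly_weighted_design_iff_span:
  fixes E :: "'n::finite set set"
  assumes "card (eigenvalues (laplacian E)) = k + 1" "t \<le> k"
  shows "uniformly_weighted_design E t W \<longleftrightarrow>
    (\<exists>c>0. (\<chi> v. (if v \<in> W then c else 0) - 1 / real CARD('n))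
      \<in> span (\<Union>i\<in>{t+1..k}. lap_eigenspace E i))"
proof -
  \<comment> \<open>\<open>averages\<close> evaluates the weights only on \<open>W\<close>, so a
    constant function may replace them.\<close>
  have "graphical_design E t W a \<longleftrightarrow> graphical_design E t W (\<lambda>_. c)"
    if "\<forall>w\<in>W. a w = c" for a c
    using that by (simp add: graphical_design_def averages_def)
  then have "uniformly_weighted_design E t W \<longleftrightarrow> (\<exists>c>0. graphical_design E t W (\<lambda>_. c))"
    unfolding uniformly_weighted_design_def by metis
  then show ?thesis
    by (simp add: graphical_design_def averages_const_iff_orthogonal
        orthogonal_low_iff_in_high[OF assms])
qed

section \<open>Row space of the eigenbasis matrix\<close>

lemma eigenbasis_matrix_span_rows:
  assumes "eigenbasis_matrix E k t B"
  shows "span (rows B) = span (\<Union>i\<in>{t+1..k}. lap_eigenspace E i)"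
proof -
  obtain S where basis: "\<forall>i\<in>{t+1..k}. is_basis (S i) (lap_eigenspace E i)"
    and B: "rows B = (\<Union>i\<in>{t+1..k}. S i)"
    using conjunct2[OF assms[unfolded eigenbasis_matrix_def]] by blast
  have S: "span (S i) = lap_eigenspace E i" if "i \<in> {t+1..k}" for i
    using basis that by (simp only: is_basis_def)
  show ?thesis
  proof (rule span_eq[THEN iffD2], intro conjI)
    show "rows B \<subseteq> span (\<Union>i\<in>{t+1..k}. lap_eigenspace E i)"
      unfolding B
    proof (rule UN_least)
      fix i
      assume i: "i \<in> {t+1..k}"
      have "S i \<subseteq> lap_eigenspace E i" using S[OF i] span_superset by blast
      also have "\<dots> \<subseteq> (\<Union>i\<in>{t+1..k}. lap_eigenspace E i)" using i by blast
      also have "\<dots> \<subseteq> span \<dots>" by (rule span_superset)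
      finally show "S i \<subseteq> span (\<Union>i\<in>{t+1..k}. lap_eigenspace E i)" .
    qed
    have "lap_eigenspace E i \<subseteq> span (rows B)" if "i \<in> {t+1..k}" for i
      unfolding S[OF that, symmetric] by (rule span_mono) (use B that in blast)
    then show "(\<Union>i\<in>{t+1..k}. lap_eigenspace E i) \<subseteq> span (rows B)" by blast
  qed
qed

text \<open>Dimensions of orthogonal eigenspaces add up, so the row space has dimension
  \<open>CARD('b)\<close> and \<open>B\<close> has full row rank. Hence a nonzero functional cannot
  vanish on the whole configuration.\<close>

lemma eigenbasis_matrix_inj:
  assumes "eigenbasis_matrix E k t B" "card (eigenvalues (laplacian E)) = k + 1"
  shows "inj (\<lambda>a. a v* B)"
proof -
  have "dim (rows B) = dim (\<Union>i\<in>{t+1..k}. lap_eigenspace E i)"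
    using eigenbasis_matrix_span_rows[OF assms(1)] by (metis dim_span)
  also have "\<dots> = (\<Sum>i\<in>{t+1..k}. dim (lap_eigenspace E i))"
    by (rule dim_Union_orthogonal) (auto intro: lap_eigenspace_orthogonal[OF assms(2)])
  also have "\<dots> = CARD('b)" using assms(1) by (simp add: eigenbasis_matrix_def)
  finally have "rank (transpose B) = CARD('b)" by (metis rank_transpose row_rank_def)
  then have "inj ((*v) (transpose B))" by (simp only: full_rank_injective)
  then show ?thesis by (simp add: inj_def)
qed

text \<open>\<open>a v* B\<close> is the combination of the rows with coefficients \<open>a\<close>;
  the rows are the images of the standard basis under the transpose.\<close>

lemma span_rows_eq_range: "span (rows B) = range (\<lambda>a. a v* B)"
  for B :: "real ^ 'n::finite ^ 'b::finite"
proof -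
  have "range (\<lambda>i::'b. axis i (1::real)) = Basis" by (auto simp: Basis_vec_def)
  then have "rows B = (*v) (transpose B) ` Basis"
    using columns_image_basis[of "transpose B"] by simp
  then have "span (rows B) = range ((*v) (transpose B))"
    using linear_span_image[OF matrix_vector_mul_linear] span_Basis by metis
  then show ?thesis by simp
qed

lemma vector_matrix_mult_nth: "(a v* B) $ j = a \<bullet> column j B"
  for B :: "real ^ 'n::finite ^ 'b::finite"
  by (simp add: vector_matrix_mult_def column_def inner_vec_def mult.commute)

lemma set_mset_eigenconfiguration: "set_mset (eigenconfiguration B) = range (\<lambda>j. column j B)"
  by (simp add: eigenconfiguration_def)

theorem theorem2p5:
  fixes E :: "'n::finite set set"
    and k t :: nat
    and B :: "real ^ 'n ^ 'b::finite"
  assumes "simple_graph E"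
    and "connected_graph E"
    and "card (eigenvalues (laplacian E)) = k + 1"
    and "1 \<le> t" and "t \<le> k - 1"
    and "eigenbasis_matrix E k t B"
  shows "(\<exists>W. W \<subset> UNIV \<and> uniformly_weighted_design E t W)
     \<longleftrightarrow> two_valued (eigenconfiguration B)"
proof -
  have tk: "t \<le> k" using assms(5) by simp
  define H where "H = range (\<lambda>a. a v* B)"
  have H: "span (\<Union>i\<in>{t+1..k}. lap_eigenspace E i) = H"
    unfolding H_def eigenbasis_matrix_span_rows[OF assms(6), symmetric]
    by (rule span_rows_eq_range)
  have design: "uniformly_weighted_design E t W \<longleftrightarrow>
      (\<exists>c>0. (\<chi> v. (if v \<in> W then c else 0) - 1 / real CARD('n)) \<in> H)" for W
    unfolding uniformly_weighted_design_iff_span[OF assms(3) tk] H ..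
  have "finite (eigenvalues (laplacian E))" using assms(3) by (intro card_ge_0_finite) simp
  then have "1 \<in> lap_eigenspace E 0" using ones_in_lap_eigenspace_0[OF assms(1)] by blast
  then have "1 \<in> span (\<Union>i\<in>{0..t}. lap_eigenspace E i)" by (intro span_base) auto
  then have "z \<bullet> 1 = 0" if "z \<in> H" for z
    using orthogonal_low_iff_in_high[OF assms(3) tk, of z, unfolded H] that by metis
  then have sum0: "(\<Sum>v\<in>UNIV. z $ v) = 0" if "z \<in> H" for z
    using that by (simp add: inner_vec_def)
  have image: "(\<lambda>x. a \<bullet> x) ` set_mset (eigenconfiguration B) = range (($) (a v* B))"
    for a by (simp add: set_mset_eigenconfiguration image_image vector_matrix_mult_nth)
  \<comment> \<open>A functional constant on the configuration gives a constant vector in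
    \<open>H\<close>; its entries sum to 0, so it is zero, and injectivity gives
    \<open>a = 0\<close>.\<close>
  have "\<not> in_affine_hyperplane (set_mset (eigenconfiguration B))"
  proof
    assume "in_affine_hyperplane (set_mset (eigenconfiguration B))"
    then obtain a c where "a \<noteq> 0" and "range (\<lambda>j. column j B) \<subseteq> {x. a \<bullet> x = c}"
      unfolding in_affine_hyperplane_def set_mset_eigenconfiguration by blast
    then have c: "(a v* B) $ j = c" for j by (auto simp: vector_matrix_mult_nth)
    have "c = 0" using sum0[of "a v* B"] by (simp add: H_def c)
    then have "a v* B = 0 v* B" using c by (simp add: vec_eq_iff)
    then have "a = 0" using eigenbasis_matrix_inj[OF assms(6,3)] by (rule injD[rotated])
    with \<open>a \<noteq> 0\<close> show False ..
  qed
  then have two: "two_valued (eigenconfiguration B) \<longleftrightarrow> (\<exists>z\<in>H. card (range (($) z)) = 2)"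
    by (simp add: two_valued_def image H_def)
  show ?thesis
    unfolding two
  proof
    assume "\<exists>W. W \<subset> UNIV \<and> uniformly_weighted_design E t W"
    then obtain W c where W: "W \<subset> UNIV" and "c > 0"
      and z: "(\<chi> v. (if v \<in> W then c else 0) - 1 / real CARD('n)) \<in> H" (is "?z \<in> H")
      using design by blast
    \<comment> \<open>For empty \<open>W\<close> the entries of \<open>?z\<close> would sum to -1.
      With \<open>W\<close> nonempty and proper, both values are attained.\<close>
    have "W \<noteq> {}"
    proof
      assume "W = {}"
      then show False using sum0[OF z] by simp
    qed
    then have "range (($) ?z) = {c - 1 / real CARD('n), - 1 / real CARD('n)}"
      using W by (auto simp: image_iff)
    then have "card (range (($) ?z)) = 2" using \<open>c > 0\<close> by simp
    then show "\<exists>z\<in>H. card (range (($) z)) = 2" using z by blast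
  next
    assume "\<exists>z\<in>H. card (range (($) z)) = 2"
    then obtain z x y where z: "z \<in> H" and "x \<noteq> y" "range (($) z) = {x, y}"
      by (auto simp: card_2_iff)
    have "\<exists>p q. p < q \<and> range (($) z) = {p, q}"
    proof (cases "x < y")
      case True
      then show ?thesis using \<open>range (($) z) = {x, y}\<close> by blast
    next
      case False
      then have "y < x" using \<open>x \<noteq> y\<close> by simp
      moreover have "range (($) z) = {y, x}" using \<open>range (($) z) = {x, y}\<close> by blast
      ultimately show ?thesis by blast
    qed
    then obtain p q where pq: "p < q" "range (($) z) = {p, q}" by blast
    then obtain u v where u: "z $ u = p" and v: "z $ v = q" by (metis imageE insertCI)
    have val: "z $ w = p \<or> z $ w = q" for w using pq(2) by blast
    \<comment> \<open>Otherwise all entries are nonnegative with sum 0, so all vanish, contradicting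
      \<open>q > p\<close>.\<close>
    have "p < 0"
    proof (rule ccontr)
      assume "\<not> p < 0"
      then have "z $ w \<ge> 0" for w using val[of w] pq(1) by linarith
      then have "z $ v = 0"
        using sum0[OF z] by (simp add: sum_nonneg_eq_0_iff)
      then show False using v \<open>\<not> p < 0\<close> pq(1) by simp
    qed
    \<comment> \<open>The factor moves the lower value \<open>p\<close> to \<open>-1/n\<close>; the
      upper value becomes \<open>s * (q - p) - 1/n\<close>, so the weight is
      \<open>s * (q - p)\<close>.\<close>
    define s where "s = - 1 / (real CARD('n) * p)"
    define W where "W = {w. z $ w = q}"
    have sp: "s * p = - 1 / real CARD('n)" using \<open>p < 0\<close> by (simp add: s_def)
    have "s > 0" using \<open>p < 0\<close> by (simp add: s_def divide_neg_neg mult_pos_neg)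
    \<comment> \<open>\<open>W\<close> is proper because the lower value is attained.\<close>
    have "u \<notin> W" using u pq(1) by (simp add: W_def)
    then have "W \<subset> UNIV" by auto
    have "z $ w = (if w \<in> W then q else p)" for w using val[of w] by (auto simp: W_def)
    then have "s *\<^sub>R z = (\<chi> w. (if w \<in> W then s * (q - p) else 0) - 1 / real CARD('n))"
      using sp by (simp add: vec_eq_iff algebra_simps)
    moreover have "s *\<^sub>R z \<in> H"
      using z unfolding H[symmetric] by (rule span_scale)
    moreover have "s * (q - p) > 0" using \<open>s > 0\<close> pq(1) by simp
    ultimately have "uniformly_weighted_design E t W" using design by metis
    with \<open>W \<subset> UNIV\<close> show "\<exists>W. W \<subset> UNIV \<and> uniformly_weighted_design E t W" by blast
  qed
qed

end
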